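(* Let $\mathcal{S}$ be Thompson's semigroup and, for an integer $n\geq 2$, let $\mathcal{F}_n$ be the free semigroup on $n$ generators. Then every derivation $D:\mathfrak{B}(\mathcal{S})\to\mathfrak{B}(\mathcal{S})$ is continuous, and every derivation $D:\mathfrak{B}(\mathcal{F}_n)\to\mathfrak{B}(\mathcal{F}_n)$ is continuous.
   Context: Thompson's semigroup $\mathcal{S}$ is the discrete semigroup with unit $e$ given by the presentation $\mathcal{S}=\langle X_0,X_1,X_2,\ldots \mid X_jX_i=X_iX_{j+1},\ j>i\rangle$; it is cancellative. The free semigroup $\mathcal{F}_n$ is taken with unit $e$ (the empty word). For a countable discrete cancellative semigroup $S$ with unit $e$, $l^2(S)$ is the Hilbert space of square-summable complex functions on $S$ with orthonormal basis $(\delta_s)_{s\in S}$; for $s\in S$, $L_s$ is the isometry of $l^2(S)$ with $L_s\delta_t=\delta_{st}$. $\mathfrak{B}(S)$ denotes the Banach algebra generated by $\{L_s: s\in S\}$ in $B(l^2(S))$ (norm-closed subalgebra). A derivation on a Banach algebra $\mathcal{A}$ is a linear map $D:\mathcal{A}\to\mathcal{A}$ (not assumed continuous) with $D(AB)=AD(B)+D(A)B$ for all $A,B\in\mathcal{A}$. *)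

theory Defs
  imports "HOL-Analysis.Analysis"
begin

section \<open>The Hilbert space of square-summable functions\<close>

definition square_summable :: "('a \<Rightarrow> complex) \<Rightarrow> bool"
  where "square_summable f \<longleftrightarrow> (\<lambda>x. (cmod (f x))\<^sup>2) summable_on UNIV"

lemma square_summable_zero: "square_summable (\<lambda>_. 0)"
  by (simp add: square_summable_def)

lemma square_summable_add:
  assumes "square_summable f" "square_summable g"
  shows "square_summable (\<lambda>x. f x + g x)"
  unfolding square_summable_def
proof (rule summable_on_comparison_test)
  show "(\<lambda>x. 2 * (cmod (f x))\<^sup>2 + 2 * (cmod (g x))\<^sup>2) summable_on UNIV"
    using assms by (intro summable_on_add summable_on_cmult_right) (simp_all add: square_summable_def)
  fix x
  have "(cmod (f x + g x))\<^sup>2 \<le> (cmod (f x) + cmod (g x))\<^sup>2"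
    by (intro power_mono norm_triangle_ineq) simp
  also have "\<dots> \<le> 2 * (cmod (f x))\<^sup>2 + 2 * (cmod (g x))\<^sup>2"
    using sum_squares_bound[of "cmod (f x)" "cmod (g x)"] by (simp add: power2_sum)
  finally show "(cmod (f x + g x))\<^sup>2 \<le> 2 * (cmod (f x))\<^sup>2 + 2 * (cmod (g x))\<^sup>2" .
qed simp

lemma square_summable_cmult:
  assumes "square_summable f"
  shows "square_summable (\<lambda>x. c * f x)"
  using assms by (simp add: square_summable_def norm_mult power_mult_distrib summable_on_cmult_right)

lemma square_summable_uminus: "square_summable f \<Longrightarrow> square_summable (\<lambda>x. - f x)"
  by (simp add: square_summable_def)

lemma square_summable_diff:
  "square_summable f \<Longrightarrow> square_summable g \<Longrightarrow> square_summable (\<lambda>x. f x - g x)"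
  using square_summable_add[of f "\<lambda>x. - g x"] square_summable_uminus[of g] by simp

lemma square_summable_inner:
  assumes "square_summable f" "square_summable g"
  shows "(\<lambda>x. f x \<bullet> g x) summable_on UNIV"
proof -
  let ?s = "\<lambda>h :: 'a \<Rightarrow> complex. \<lambda>x. (cmod (h x))\<^sup>2"
  have "(\<lambda>x. 1 / 2 * (?s (\<lambda>x. f x + g x) x + - 1 * (?s f x + ?s g x))) summable_on UNIV"
    using assms square_summable_add[OF assms]
    by (intro summable_on_cmult_right summable_on_add) (simp_all only: square_summable_def)
  moreover have "1 / 2 * (?s (\<lambda>x. f x + g x) x + - 1 * (?s f x + ?s g x)) = f x \<bullet> g x" for x
    by (simp add: power2_norm_eq_inner inner_add_left inner_add_right inner_commute)
  ultimately show ?thesis by simp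
qed

lemma square_summable_bdd:
  assumes "\<And>F. finite F \<Longrightarrow> (\<Sum>x\<in>F. (cmod (f x))\<^sup>2) \<le> b"
  shows "square_summable f"
  unfolding square_summable_def
  by (rule nonneg_bdd_above_summable_on) (use assms in \<open>auto intro!: bdd_aboveI2\<close>)

typedef 'a ell2 = "{f :: 'a \<Rightarrow> complex. square_summable f}"
  morphisms ell2_fun Abs_ell2
  using square_summable_zero by blast

setup_lifting type_definition_ell2

instantiation ell2 :: (type) real_vector
begin
lift_definition zero_ell2 :: "'a ell2" is "\<lambda>_. 0" by (rule square_summable_zero)
lift_definition plus_ell2 :: "'a ell2 \<Rightarrow> 'a ell2 \<Rightarrow> 'a ell2" is "\<lambda>f g x. f x + g x"
  by (rule square_summable_add)
lift_definition minus_ell2 :: "'a ell2 \<Rightarrow> 'a ell2 \<Rightarrow> 'a ell2" is "\<lambda>f g x. f x - g x"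
  by (rule square_summable_diff)
lift_definition uminus_ell2 :: "'a ell2 \<Rightarrow> 'a ell2" is "\<lambda>f x. - f x"
  by (rule square_summable_uminus)
lift_definition scaleR_ell2 :: "real \<Rightarrow> 'a ell2 \<Rightarrow> 'a ell2" is "\<lambda>r f x. of_real r * f x"
  by (rule square_summable_cmult)
instance
  by standard (transfer; force simp: algebra_simps)+
end

text \<open>This is the real part of the complex inner product of \<open>\<ell>\<^sup>2\<close>, since
  \<^prop>\<open>z \<bullet> w = Re (cnj z * w)\<close> for complex numbers; it induces the usual norm.\<close>

instantiation ell2 :: (type) real_inner
begin
lift_definition inner_ell2 :: "'a ell2 \<Rightarrow> 'a ell2 \<Rightarrow> real" is "\<lambda>f g. \<Sum>\<^sub>\<infinity>x. f x \<bullet> g x" .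
definition norm_ell2 :: "'a ell2 \<Rightarrow> real"
  where "norm_ell2 f = sqrt (\<Sum>\<^sub>\<infinity>x. (cmod (ell2_fun f x))\<^sup>2)"
definition dist_ell2 :: "'a ell2 \<Rightarrow> 'a ell2 \<Rightarrow> real"
  where "dist_ell2 f g = norm (f - g)"
definition sgn_ell2 :: "'a ell2 \<Rightarrow> 'a ell2"
  where "sgn_ell2 f = inverse (norm f) *\<^sub>R f"
definition uniformity_ell2 :: "('a ell2 \<times> 'a ell2) filter"
  where "uniformity_ell2 = (INF e\<in>{0<..}. principal {(f, g). dist f g < e})"
definition open_ell2 :: "'a ell2 set \<Rightarrow> bool"
  where "open_ell2 U \<longleftrightarrow> (\<forall>f\<in>U. \<forall>\<^sub>F (f', g) in uniformity. f' = f \<longrightarrow> g \<in> U)"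
instance
proof
  fix x y z :: "'a ell2" and r :: real
  show "x \<bullet> y = y \<bullet> x"
    by transfer (simp add: inner_commute)
  show "(x + y) \<bullet> z = x \<bullet> z + y \<bullet> z"
    by transfer (simp add: inner_add_left infsum_add square_summable_inner)
  show "r *\<^sub>R x \<bullet> y = r * (x \<bullet> y)"
  proof transfer
    fix r :: real and f g :: "'a \<Rightarrow> complex"
    have "(complex_of_real r * f u) \<bullet> g u = r * (f u \<bullet> g u)" for u
      by (simp add: scaleR_conv_of_real[symmetric])
    then show "(\<Sum>\<^sub>\<infinity>u. (complex_of_real r * f u) \<bullet> g u) = r * (\<Sum>\<^sub>\<infinity>u. f u \<bullet> g u)"
      by (simp add: infsum_cmult_right')
  qed
  show "0 \<le> x \<bullet> x"
    by transfer (simp add: infsum_nonneg)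
  show "x \<bullet> x = 0 \<longleftrightarrow> x = 0"
  proof transfer
    fix f :: "'a \<Rightarrow> complex" assume "square_summable f"
    then have s: "(\<lambda>u. f u \<bullet> f u) summable_on UNIV"
      by (rule square_summable_inner[OF _ \<open>square_summable f\<close>])
    show "(\<Sum>\<^sub>\<infinity>u. f u \<bullet> f u) = 0 \<longleftrightarrow> f = (\<lambda>_. 0)"
    proof
      assume *: "(\<Sum>\<^sub>\<infinity>u. f u \<bullet> f u) = 0"
      have "f u \<bullet> f u = 0" for u
        by (rule nonneg_infsum_le_0D[OF _ s]) (use * in auto)
      then show "f = (\<lambda>_. 0)" by auto
    qed simp
  qed
  show "norm x = sqrt (x \<bullet> x)"
    by (simp add: norm_ell2_def inner_ell2.rep_eq power2_norm_eq_inner)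
qed (simp_all add: dist_ell2_def sgn_ell2_def uniformity_ell2_def open_ell2_def)
end

lemma power2_norm_ell2: "(norm f)\<^sup>2 = (\<Sum>\<^sub>\<infinity>x. (cmod (ell2_fun f x))\<^sup>2)"
  by (simp add: norm_ell2_def infsum_nonneg)

lemma summable_ell2: "(\<lambda>x. (cmod (ell2_fun f x))\<^sup>2) summable_on UNIV"
  using ell2_fun[of f] by (simp add: square_summable_def)

lemma sum_le_norm_ell2: "finite F \<Longrightarrow> (\<Sum>x\<in>F. (cmod (ell2_fun f x))\<^sup>2) \<le> (norm f)\<^sup>2"
  unfolding power2_norm_ell2 by (rule finite_sum_le_infsum[OF summable_ell2]) auto

lemma norm_ell2_component: "cmod (ell2_fun f x) \<le> norm f"
  by (rule power2_le_imp_le) (use sum_le_norm_ell2[of "{x}" f] in simp_all)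

lemma norm_ell2_le:
  assumes "\<And>F. finite F \<Longrightarrow> (\<Sum>x\<in>F. (cmod (ell2_fun f x))\<^sup>2) \<le> b\<^sup>2" "0 \<le> b"
  shows "norm f \<le> b"
proof -
  have "(norm f)\<^sup>2 \<le> b\<^sup>2"
    unfolding power2_norm_ell2 by (rule infsum_le_finite_sums[OF summable_ell2]) (rule assms)
  then show ?thesis using assms(2) by (rule power2_le_imp_le)
qed

instance ell2 :: (type) banach
proof
  fix X :: "nat \<Rightarrow> 'a ell2" assume X: "Cauchy X"
  have "Cauchy (\<lambda>n. ell2_fun (X n) x)" for x
  proof (rule metric_CauchyI)
    fix e :: real assume "0 < e"
    then obtain M where M: "\<And>m n. m \<ge> M \<Longrightarrow> n \<ge> M \<Longrightarrow> dist (X m) (X n) < e"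
      using X by (meson metric_CauchyD)
    have "dist (ell2_fun (X m) x) (ell2_fun (X n) x) \<le> dist (X m) (X n)" for m n
      using norm_ell2_component[of "X m - X n" x] by (simp add: dist_norm minus_ell2.rep_eq)
    then show "\<exists>M. \<forall>m\<ge>M. \<forall>n\<ge>M. dist (ell2_fun (X m) x) (ell2_fun (X n) x) < e"
      using M by (meson le_less_trans)
  qed
  then have "\<forall>x. \<exists>l. (\<lambda>n. ell2_fun (X n) x) \<longlonglongrightarrow> l"
    by (simp add: Cauchy_convergent_iff convergent_def)
  then obtain f where f: "\<And>x. (\<lambda>n. ell2_fun (X n) x) \<longlonglongrightarrow> f x" by metis
  have fin: "(\<Sum>x\<in>F. (cmod (ell2_fun (X m) x - f x))\<^sup>2) \<le> e\<^sup>2"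
    if "finite F" and M: "\<And>n. n \<ge> M \<Longrightarrow> dist (X m) (X n) \<le> e" for F m M e
  proof (rule tendsto_upperbound)
    show "(\<lambda>n. \<Sum>x\<in>F. (cmod (ell2_fun (X m) x - ell2_fun (X n) x))\<^sup>2)
        \<longlonglongrightarrow> (\<Sum>x\<in>F. (cmod (ell2_fun (X m) x - f x))\<^sup>2)"
      by (intro tendsto_intros f)
    show "\<forall>\<^sub>F n in sequentially. (\<Sum>x\<in>F. (cmod (ell2_fun (X m) x - ell2_fun (X n) x))\<^sup>2) \<le> e\<^sup>2"
    proof (rule eventually_sequentiallyI)
      fix n assume "n \<ge> M"
      have "(\<Sum>x\<in>F. (cmod (ell2_fun (X m) x - ell2_fun (X n) x))\<^sup>2) \<le> (norm (X m - X n))\<^sup>2"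
        using sum_le_norm_ell2[OF \<open>finite F\<close>, of "X m - X n"] by (simp add: minus_ell2.rep_eq)
      also have "\<dots> \<le> e\<^sup>2"
        using M[OF \<open>n \<ge> M\<close>] by (intro power_mono) (auto simp: dist_norm)
      finally show "(\<Sum>x\<in>F. (cmod (ell2_fun (X m) x - ell2_fun (X n) x))\<^sup>2) \<le> e\<^sup>2" .
    qed
  qed simp
  obtain M where M: "\<And>m n. m \<ge> M \<Longrightarrow> n \<ge> M \<Longrightarrow> dist (X m) (X n) < 1"
    using X by (meson metric_CauchyD zero_less_one)
  have "square_summable (\<lambda>x. ell2_fun (X M) x - f x)"
    by (rule square_summable_bdd[where b = "1\<^sup>2"], rule fin[where M = M]) (use M in \<open>auto intro: less_imp_le\<close>)
  from square_summable_diff[OF _ this, of "ell2_fun (X M)"]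
  have "square_summable (\<lambda>x. ell2_fun (X M) x - (ell2_fun (X M) x - f x))"
    using ell2_fun[of "X M"] by blast
  then have sf: "square_summable f" by simp
  have "X \<longlonglongrightarrow> Abs_ell2 f"
  proof (rule metric_LIMSEQ_I)
    fix e :: real assume "0 < e"
    then obtain N where N: "\<And>m n. m \<ge> N \<Longrightarrow> n \<ge> N \<Longrightarrow> dist (X m) (X n) < e / 2"
      using X by (meson metric_CauchyD half_gt_zero)
    have "dist (X m) (Abs_ell2 f) < e" if "m \<ge> N" for m
    proof -
      have "norm (X m - Abs_ell2 f) \<le> e / 2"
      proof (rule norm_ell2_le)
        fix F :: "'a set" assume "finite F"
        then show "(\<Sum>x\<in>F. (cmod (ell2_fun (X m - Abs_ell2 f) x))\<^sup>2) \<le> (e / 2)\<^sup>2"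
          using fin[of F N m "e / 2"] N that sf
          by (simp add: minus_ell2.rep_eq Abs_ell2_inverse less_imp_le)
      qed (use \<open>0 < e\<close> in simp)
      then show ?thesis using \<open>0 < e\<close> by (simp add: dist_norm)
    qed
    then show "\<exists>N. \<forall>n\<ge>N. dist (X n) (Abs_ell2 f) < e" by blast
  qed
  then show "convergent X" by (auto simp: convergent_def)
qed

lift_definition ell2_scaleC :: "complex \<Rightarrow> 'a ell2 \<Rightarrow> 'a ell2"  (infixr \<open>*\<^sub>C\<close> 75)
  is "\<lambda>c f x. c * f x"
  by (rule square_summable_cmult)

lemma norm_ell2_scaleC: "norm (c *\<^sub>C f) = cmod c * norm f"
proof -
  have "(norm (c *\<^sub>C f))\<^sup>2 = (cmod c * norm f)\<^sup>2"
    by (simp add: power2_norm_ell2 ell2_scaleC.rep_eq norm_mult power_mult_distrib infsum_cmult_right')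
  then show ?thesis by (simp add: power2_eq_iff_nonneg)
qed

lift_definition delta :: "'a \<Rightarrow> 'a ell2" is "\<lambda>s t. if t = s then 1 else 0"
proof (rule square_summable_bdd[where b = 1])
  fix s :: 'a and F :: "'a set" assume "finite F"
  have "(\<Sum>t\<in>F. (cmod (if t = s then 1 else 0))\<^sup>2) = (\<Sum>t\<in>F. if t = s then 1 else 0)"
    by (rule sum.cong) auto
  also have "\<dots> = (if s \<in> F then 1 else 0 :: real)"
    using \<open>finite F\<close> by (rule sum.delta)
  also have "\<dots> \<le> 1" by simp
  finally show "(\<Sum>t\<in>F. (cmod (if t = s then 1 else 0))\<^sup>2) \<le> 1" .
qed


section \<open>Operators\<close>

text \<open>The type \<^typ>\<open>'a ell2 \<Rightarrow>\<^sub>L 'a ell2\<close> carries the operator norm but consists of all bounded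
  \<^emph>\<open>real\<close>-linear maps; \<open>B(\<ell>\<^sup>2)\<close> is the subset of the complex-linear ones.\<close>

type_synonym 'a operator = "'a ell2 \<Rightarrow>\<^sub>L 'a ell2"

definition bounded_operators :: "'a operator set"
  where "bounded_operators = {T. \<forall>c f. blinfun_apply T (c *\<^sub>C f) = c *\<^sub>C blinfun_apply T f}"

lemma bounded_linear_ell2_scaleC: "bounded_linear ((*\<^sub>C) c :: 'a ell2 \<Rightarrow> 'a ell2)"
proof (rule bounded_linear_intro)
  show "c *\<^sub>C (f + g) = c *\<^sub>C f + c *\<^sub>C g" for f g :: "'a ell2"
    by transfer (simp add: algebra_simps)
  show "c *\<^sub>C (r *\<^sub>R f) = r *\<^sub>R (c *\<^sub>C f)" for r and f :: "'a ell2"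
    by transfer (simp add: algebra_simps)
  show "norm (c *\<^sub>C f) \<le> norm f * cmod c" for f :: "'a ell2"
    by (simp add: norm_ell2_scaleC)
qed

definition operator_scaleC :: "complex \<Rightarrow> 'a operator \<Rightarrow> 'a operator"  (infixr \<open>*\<^sub>O\<close> 75)
  where "c *\<^sub>O T = Blinfun (\<lambda>f. c *\<^sub>C blinfun_apply T f)"

lemma operator_scaleC_apply [simp]: "blinfun_apply (c *\<^sub>O T) f = c *\<^sub>C blinfun_apply T f"
  by (simp add: operator_scaleC_def bounded_linear_Blinfun_apply
      bounded_linear_compose[OF bounded_linear_ell2_scaleC blinfun.bounded_linear_right])

definition closed_subalgebra :: "'a operator set \<Rightarrow> bool"
  where "closed_subalgebra A \<longleftrightarrow>
    A \<subseteq> bounded_operators \<and> closed A \<and> 0 \<in> A \<and>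
    (\<forall>S\<in>A. \<forall>T\<in>A. S + T \<in> A) \<and>
    (\<forall>c. \<forall>T\<in>A. c *\<^sub>O T \<in> A) \<and>
    (\<forall>S\<in>A. \<forall>T\<in>A. S o\<^sub>L T \<in> A)"

definition generated_banach_algebra :: "'a operator set \<Rightarrow> 'a operator set"
  where "generated_banach_algebra G = \<Inter>{A. closed_subalgebra A \<and> G \<subseteq> A}"

text \<open>No continuity is required. Only the values of \<open>D\<close> on \<open>A\<close> matter.\<close>

definition derivation_on :: "'a operator set \<Rightarrow> ('a operator \<Rightarrow> 'a operator) \<Rightarrow> bool"
  where "derivation_on A D \<longleftrightarrow>
    D ` A \<subseteq> A \<and>
    (\<forall>S\<in>A. \<forall>T\<in>A. D (S + T) = D S + D T) \<and>
    (\<forall>c. \<forall>T\<in>A. D (c *\<^sub>O T) = c *\<^sub>O D T) \<and>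
    (\<forall>S\<in>A. \<forall>T\<in>A. D (S o\<^sub>L T) = (S o\<^sub>L D T) + (D S o\<^sub>L T))"

lemma closed_subalgebra_bounded_operators: "closed_subalgebra bounded_operators"
proof -
  have "closed {T :: 'a operator. blinfun_apply T (c *\<^sub>C f) = c *\<^sub>C blinfun_apply T f}" for c f
  proof -
    have "c *\<^sub>C blinfun_apply T f = blinfun_apply (c *\<^sub>O id_blinfun) (blinfun_apply T f)" for T :: "'a operator"
      by (simp add: operator_scaleC_apply)
    then show ?thesis
      by (simp only:) (intro closed_Collect_eq continuous_intros)
  qed
  then have "closed (bounded_operators :: 'a operator set)"
    unfolding bounded_operators_def by (intro closed_Collect_all)
  moreover have "c *\<^sub>C (f + g) = c *\<^sub>C f + c *\<^sub>C g" "c *\<^sub>C 0 = (0 :: 'a ell2)"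
    "c *\<^sub>C d *\<^sub>C f = d *\<^sub>C c *\<^sub>C f" for c d and f g :: "'a ell2"
    by (transfer; simp add: algebra_simps)+
  ultimately show ?thesis
    by (auto simp: closed_subalgebra_def bounded_operators_def operator_scaleC_apply
        blinfun.add_left blinfun.zero_left)
qed

lemma closed_subalgebra_generated:
  assumes "G \<subseteq> bounded_operators"
  shows "closed_subalgebra (generated_banach_algebra G)" "G \<subseteq> generated_banach_algebra G"
proof -
  have "closed (generated_banach_algebra G)"
    unfolding generated_banach_algebra_def by (rule closed_Inter) (auto simp: closed_subalgebra_def)
  moreover have "generated_banach_algebra G \<subseteq> bounded_operators"
    using assms closed_subalgebra_bounded_operators unfolding generated_banach_algebra_def by blast
  ultimately show "closed_subalgebra (generated_banach_algebra G)"
    by (auto simp: closed_subalgebra_def generated_banach_algebra_def)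
  show "G \<subseteq> generated_banach_algebra G"
    by (auto simp: generated_banach_algebra_def)
qed


section \<open>The Banach algebra of a cancellative semigroup with unit\<close>

class cancellative_monoid = monoid_mult +
  assumes mult_left_cancellative: "a * b = a * c \<Longrightarrow> b = c"
    and mult_right_cancellative: "b * a = c * a \<Longrightarrow> b = c"

lemma inj_mult_left: "inj (\<lambda>t. s * t)" for s :: "'s::cancellative_monoid"
  by (auto intro: injI mult_left_cancellative)

definition left_translate :: "'s::cancellative_monoid \<Rightarrow> ('s \<Rightarrow> complex) \<Rightarrow> 's \<Rightarrow> complex"
  where "left_translate s f u = (if u \<in> range (\<lambda>t. s * t) then f (inv (\<lambda>t. s * t) u) else 0)"

lemma left_translate_mult [simp]: "left_translate s f (s * t) = f t"
  by (simp add: left_translate_def inj_mult_left)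

lemma left_translate_outside: "u \<notin> range (\<lambda>t. s * t) \<Longrightarrow> left_translate s f u = 0"
  by (simp add: left_translate_def)

lemma left_translate_has_sum:
  "((\<lambda>u. (cmod (left_translate s f u))\<^sup>2) has_sum a) UNIV \<longleftrightarrow> ((\<lambda>t. (cmod (f t))\<^sup>2) has_sum a) UNIV"
proof -
  have "((\<lambda>u. (cmod (left_translate s f u))\<^sup>2) has_sum a) UNIV \<longleftrightarrow>
      ((\<lambda>u. (cmod (left_translate s f u))\<^sup>2) has_sum a) (range (\<lambda>t. s * t))"
    by (rule has_sum_cong_neutral) (auto simp: left_translate_outside)
  also have "\<dots> \<longleftrightarrow> ((\<lambda>t. (cmod (f t))\<^sup>2) has_sum a) UNIV"
    by (simp add: has_sum_reindex[OF inj_mult_left] o_def)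
  finally show ?thesis .
qed

lift_definition ell2_left_translate :: "'s::cancellative_monoid \<Rightarrow> 's ell2 \<Rightarrow> 's ell2"
  is left_translate
  by (simp add: square_summable_def summable_on_def left_translate_has_sum)

lemma norm_ell2_left_translate: "norm (ell2_left_translate s f) = norm f"
  using infsumI[OF iffD2[OF left_translate_has_sum has_sum_infsum[OF summable_ell2]]]
  by (simp add: norm_ell2_def ell2_left_translate.rep_eq)

lemma bounded_linear_ell2_left_translate: "bounded_linear (ell2_left_translate s)"
proof (rule bounded_linear_intro[where K = 1])
  show "ell2_left_translate s (f + g) = ell2_left_translate s f + ell2_left_translate s g" for f g
    by transfer (simp add: fun_eq_iff left_translate_def)
  show "ell2_left_translate s (r *\<^sub>R f) = r *\<^sub>R ell2_left_translate s f" for r f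
    by transfer (simp add: fun_eq_iff left_translate_def)
qed (simp add: norm_ell2_left_translate)

definition left_mult_op :: "'s::cancellative_monoid \<Rightarrow> 's operator"
  where "left_mult_op s = Blinfun (ell2_left_translate s)"

lemma left_mult_op_apply: "blinfun_apply (left_mult_op s) = ell2_left_translate s"
  by (simp add: left_mult_op_def bounded_linear_Blinfun_apply bounded_linear_ell2_left_translate)

lemma left_mult_op_delta: "blinfun_apply (left_mult_op s) (delta t) = delta (s * t)"
proof -
  have "left_translate s (\<lambda>v. if v = t then 1 else 0) u = (if u = s * t then 1 else 0)" for u
    by (cases "u \<in> range (\<lambda>t. s * t)")
      (auto simp: left_translate_outside dest: mult_left_cancellative)
  then show ?thesis
    unfolding left_mult_op_apply by transfer (simp add: fun_eq_iff)
qed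

lemma left_mult_op_isometry: "norm (blinfun_apply (left_mult_op s) f) = norm f"
  by (simp add: left_mult_op_apply norm_ell2_left_translate)

lemma left_mult_op_bounded_operators: "range left_mult_op \<subseteq> bounded_operators"
proof -
  have "ell2_left_translate s (c *\<^sub>C f) = c *\<^sub>C ell2_left_translate s f" for s :: 'a and c f
    by transfer (simp add: fun_eq_iff left_translate_def)
  then show ?thesis by (auto simp: bounded_operators_def left_mult_op_apply)
qed

definition semigroup_banach_algebra :: "'s::cancellative_monoid operator set"
  where "semigroup_banach_algebra = generated_banach_algebra (range left_mult_op)"


section \<open>Thompson's semigroup\<close>

text \<open>A word \<open>[i\<^sub>1, \<dots>, i\<^sub>k]\<close> stands for \<open>X\<^bsub>i\<^sub>1\<^esub> \<cdots> X\<^bsub>i\<^sub>k\<^esub>\<close>; the relation is the least congruence on words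
  containing the defining relations.\<close>

inductive thompson_eq :: "nat list \<Rightarrow> nat list \<Rightarrow> bool" where
  relation: "i < j \<Longrightarrow> thompson_eq [j, i] [i, Suc j]"
| refl: "thompson_eq u u"
| sym: "thompson_eq u v \<Longrightarrow> thompson_eq v u"
| trans: "thompson_eq u v \<Longrightarrow> thompson_eq v w \<Longrightarrow> thompson_eq u w"
| append: "thompson_eq u u' \<Longrightarrow> thompson_eq v v' \<Longrightarrow> thompson_eq (u @ v) (u' @ v')"

quotient_type thompson = "nat list" / thompson_eq
  by (rule equivpI)
    (auto intro!: reflpI sympI transpI intro: thompson_eq.refl thompson_eq.sym thompson_eq.trans)

lift_definition thompson_gen :: "nat \<Rightarrow> thompson" is "\<lambda>i. [i]" .

text \<open>Cancellativity is obtained from two normal forms: \<open>insert_left j w\<close> moves \<open>X\<^sub>j\<close> into the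
  normal word \<open>w\<close> from the left, and \<open>insert_right i w\<close> moves \<open>X\<^sub>i\<close> from the right into the normal
  word whose \<^emph>\<open>reversal\<close> is \<open>w\<close>.\<close>

fun insert_left :: "nat \<Rightarrow> nat list \<Rightarrow> nat list" where
  "insert_left j [] = [j]"
| "insert_left j (i # w) = (if i < j then i # insert_left (Suc j) w else j # i # w)"

fun insert_right :: "nat \<Rightarrow> nat list \<Rightarrow> nat list" where
  "insert_right i [] = [i]"
| "insert_right i (j # w) = (if i < j then Suc j # insert_right i w else i # j # w)"

lemma insert_left_relation:
  "i < j \<Longrightarrow> insert_left j (insert_left i w) = insert_left i (insert_left (Suc j) w)"
  by (induction w arbitrary: i j) auto

lemma insert_right_relation:
  "i < j \<Longrightarrow> insert_right i (insert_right j w) = insert_right (Suc j) (insert_right i w)"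
  by (induction w arbitrary: i j) auto

lemma insert_left_nonempty [simp]: "insert_left j w \<noteq> []"
  by (cases w) auto

lemma insert_right_nonempty [simp]: "insert_right i w \<noteq> []"
  by (cases w) auto

lemma insert_left_inject: "insert_left j v = insert_left j w \<Longrightarrow> v = w"
proof (induction v arbitrary: j w)
  case Nil
  then show ?case by (cases w) (auto split: if_splits)
next
  case (Cons i v)
  then show ?case by (cases w) (auto split: if_splits)
qed

lemma insert_right_inject: "insert_right i v = insert_right i w \<Longrightarrow> v = w"
proof (induction v arbitrary: w)
  case Nil
  then show ?case by (cases w) (auto split: if_splits)
next
  case (Cons j v)
  then show ?case by (cases w) (auto split: if_splits)
qed

lemma thompson_eq_insert_left: "thompson_eq (j # w) (insert_left j w)"
proof (induction w arbitrary: j)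
  case (Cons i w)
  show ?case
  proof (cases "i < j")
    case True
    have "thompson_eq ([j, i] @ w) ([i, Suc j] @ w)"
      by (intro thompson_eq.append thompson_eq.relation thompson_eq.refl True)
    moreover have "thompson_eq ([i] @ Suc j # w) ([i] @ insert_left (Suc j) w)"
      by (intro thompson_eq.append thompson_eq.refl Cons)
    ultimately show ?thesis using True by (auto intro: thompson_eq.trans)
  qed (simp add: thompson_eq.refl)
qed (simp add: thompson_eq.refl)

lemma thompson_eq_insert_right: "thompson_eq (rev w @ [i]) (rev (insert_right i w))"
proof (induction w)
  case (Cons j w)
  show ?case
  proof (cases "i < j")
    case True
    have "thompson_eq (rev w @ [j, i]) (rev w @ [i, Suc j])"
      by (intro thompson_eq.append thompson_eq.relation thompson_eq.refl True)
    moreover have "thompson_eq ((rev w @ [i]) @ [Suc j]) (rev (insert_right i w) @ [Suc j])"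
      by (intro thompson_eq.append thompson_eq.refl Cons)
    ultimately show ?thesis using True by (auto intro: thompson_eq.trans)
  qed (simp add: thompson_eq.refl)
qed (simp add: thompson_eq.refl)

lemma thompson_eq_foldr: "thompson_eq u v \<Longrightarrow> foldr insert_left u = foldr insert_left v"
  by (induction rule: thompson_eq.induct) (auto simp: fun_eq_iff insert_left_relation)

lemma thompson_eq_fold: "thompson_eq u v \<Longrightarrow> fold insert_right u = fold insert_right v"
  by (induction rule: thompson_eq.induct) (auto simp: fun_eq_iff insert_right_relation)

lemma thompson_eq_normal_left: "thompson_eq u (foldr insert_left u [])"
proof (induction u)
  case (Cons i u)
  have "thompson_eq ([i] @ u) ([i] @ foldr insert_left u [])"
    by (intro thompson_eq.append thompson_eq.refl Cons)
  also have "thompson_eq \<dots> (insert_left i (foldr insert_left u []))"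
    using thompson_eq_insert_left by simp
  finally (thompson_eq.trans) show ?case by simp
qed (simp add: thompson_eq.refl)

lemma thompson_eq_normal_right: "thompson_eq u (rev (fold insert_right u []))"
proof (induction u rule: rev_induct)
  case (snoc i u)
  have "thompson_eq (u @ [i]) (rev (fold insert_right u []) @ [i])"
    by (intro thompson_eq.append thompson_eq.refl snoc)
  also have "thompson_eq \<dots> (rev (insert_right i (fold insert_right u [])))"
    by (rule thompson_eq_insert_right)
  finally (thompson_eq.trans) show ?case by simp
qed (simp add: thompson_eq.refl)

lemma thompson_eq_left_cancel:
  assumes "thompson_eq (u @ v) (u @ w)" shows "thompson_eq v w"
proof -
  have "foldr insert_left u (foldr insert_left v []) = foldr insert_left u (foldr insert_left w [])"
    using thompson_eq_foldr[OF assms] by (auto simp: fun_eq_iff)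
  then have "foldr insert_left v [] = foldr insert_left w []"
    by (induction u) (auto dest: insert_left_inject)
  then show ?thesis
    by (metis thompson_eq_normal_left thompson_eq.sym thompson_eq.trans)
qed

lemma thompson_eq_right_cancel:
  assumes "thompson_eq (v @ u) (w @ u)" shows "thompson_eq v w"
proof -
  have "fold insert_right u (fold insert_right v []) = fold insert_right u (fold insert_right w [])"
    using thompson_eq_fold[OF assms] by (auto simp: fun_eq_iff)
  then have "fold insert_right v [] = fold insert_right w []"
    by (induction u rule: rev_induct) (auto dest: insert_right_inject)
  then show ?thesis
    by (metis thompson_eq_normal_right thompson_eq.sym thompson_eq.trans)
qed

instantiation thompson :: cancellative_monoid
begin
lift_definition one_thompson :: thompson is "[]" .
lift_definition times_thompson :: "thompson \<Rightarrow> thompson \<Rightarrow> thompson" is "(@)"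
  by (rule thompson_eq.append)
instance
  by standard
    (transfer; auto intro: thompson_eq.refl thompson_eq_left_cancel thompson_eq_right_cancel)+
end

lemma thompson_gen_relation:
  "i < j \<Longrightarrow> thompson_gen j * thompson_gen i = thompson_gen i * thompson_gen (Suc j)"
  by transfer (simp add: thompson_eq.relation)


section \<open>Free semigroups with unit\<close>

text \<open>Words over the alphabet \<^typ>\<open>'n\<close>, whose elements are the free generators; the free semigroup on
  \<open>n\<close> generators is obtained for \<open>CARD('n) = n\<close>.\<close>

datatype 'n free_semigroup = Word (letters: "'n list")

instantiation free_semigroup :: (type) cancellative_monoid
begin
definition one_free_semigroup :: "'n free_semigroup"
  where "one_free_semigroup = Word []"
definition times_free_semigroup :: "'n free_semigroup \<Rightarrow> 'n free_semigroup \<Rightarrow> 'n free_semigroup"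
  where "times_free_semigroup u v = Word (letters u @ letters v)"
instance
  by standard (auto simp: one_free_semigroup_def times_free_semigroup_def free_semigroup.expand)
end

end

theory Submission
  imports Defs
begin

text \<open>
  Both parts are instances of one fact about a cancellative monoid \<open>M\<close>: if some \<open>s\<close> satisfies
  \<open>\<Inter>\<^sub>n s\<^sup>n M = \<emptyset>\<close>, then every derivation \<open>D\<close> of the Banach algebra of \<open>M\<close> is continuous. In
  Thompson's semigroup and in a free semigroup any generator \<open>s\<close> qualifies, because word length is
  additive, so that every element of \<open>s\<^sup>n M\<close> has length at least \<open>n\<close>.

  The proof is a gliding hump argument. Let \<open>V\<^sub>n\<close> be left translation by \<open>s\<^sup>n\<close>. Left multiplication
  by the isometry \<open>V\<^sub>n\<close> preserves norms of operators, and \<open>D (V\<^sub>n B) = V\<^sub>n (D B) + (D V\<^sub>n) B\<close>. Two facts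
  play against each other.

  \<^item> If \<open>D\<close> is discontinuous, then \<open>D\<close> is already unbounded on arbitrarily small elements of
    \<open>V\<^sub>n \<AA>\<close>, since \<open>V\<^sub>n (D B)\<close> is as large as \<open>D B\<close> and \<open>(D V\<^sub>n) B\<close> is controlled by the norm of
    \<open>B\<close> (\<open>unbounded_on_translates\<close>).

  \<^item> For a given operator \<open>T\<close>, no perturbation of the form \<open>V\<^sub>n X\<close> with \<open>n\<close> large can reduce the norm
    of \<open>T\<close> noticeably, since almost all of \<open>T f\<close> lives on a finite set, which \<open>s\<^sup>n M\<close> avoids
    for large \<open>n\<close> (\<open>norm_stable_under_translates\<close>).

  Hence inside every set \<open>S + V\<^sub>n (\<epsilon>-ball of \<AA>)\<close>, called a cell below, there is a smaller
  cell on which \<open>D\<close> is as large as desired: the first fact provides a new centre \<open>S'\<close> with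
  \<open>D S'\<close> large, the second one an exponent \<open>n'\<close> for which the unknown term \<open>V\<^sub>n\<^sub>' (D B)\<close> cannot
  undo this, and a small radius controls \<open>(D V\<^sub>n\<^sub>') B\<close> (\<open>cell_refinement\<close>). The point
  common to a shrinking sequence of such cells would be an operator \<open>T\<close> with \<open>D T\<close> of infinite norm.
\<close>


section \<open>Composition with the translation isometries\<close>

lemma left_mult_op_compose: "left_mult_op s o\<^sub>L left_mult_op t = left_mult_op (s * t)"
proof -
  have "left_translate s (left_translate t f) u = left_translate (s * t) f u" for f u
  proof (cases "u \<in> range (\<lambda>v. s * v)")
    case True
    then obtain v where v: "u = s * v" by blast
    show ?thesis
    proof (cases "v \<in> range (\<lambda>w. t * w)")
      case True
      then obtain w where "v = t * w" by blast
      then show ?thesis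
        using left_translate_mult[of "s * t" f w] by (simp add: v mult.assoc)
    next
      case False
      then have "u \<notin> range (\<lambda>w. (s * t) * w)"
        by (auto simp: v mult.assoc dest: mult_left_cancellative)
      with False show ?thesis by (simp add: v left_translate_outside)
    qed
  next
    case False
    then have "u \<notin> range (\<lambda>w. (s * t) * w)" by (auto simp: mult.assoc)
    with False show ?thesis by (simp add: left_translate_outside)
  qed
  then have "ell2_left_translate s (ell2_left_translate t f) = ell2_left_translate (s * t) f" for f
    by transfer (simp add: fun_eq_iff)
  then show ?thesis
    by (intro blinfun_eqI) (simp add: left_mult_op_apply)
qed

lemma norm_left_mult_op_compose: "norm (left_mult_op s o\<^sub>L T) = norm T"
  by (simp add: norm_blinfun.rep_eq onorm_def left_mult_op_isometry)

lemma bounded_linear_compose_left: "bounded_linear (\<lambda>T. S o\<^sub>L T)"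
  by (rule bounded_bilinear.bounded_linear_right[OF bounded_bilinear_blinfun_compose])

lemma left_mult_op_apply_outside:
  "x \<notin> range (\<lambda>t. s * t) \<Longrightarrow> ell2_fun (blinfun_apply (left_mult_op s) f) x = 0"
  by (simp add: left_mult_op_apply ell2_left_translate.rep_eq left_translate_outside)

text \<open>The values of \<open>T f\<close> on a finite set \<open>F\<close> account for a norm above \<open>c\<close>; once \<open>s\<^sup>n M\<close> avoids
  \<open>F\<close>, the function \<open>(V\<^sub>n X) f\<close> vanishes on \<open>F\<close> and cannot alter these values.\<close>

lemma norm_stable_under_translates:
  fixes T :: "'s::cancellative_monoid operator"
  assumes empty: "\<And>x. \<exists>n. x \<notin> range (\<lambda>t. s ^ n * t)" and c: "c < norm T"
  shows "\<exists>n. \<forall>X. c \<le> norm (T + (left_mult_op (s ^ n) o\<^sub>L X))"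
proof (cases "c < 0")
  case True
  then show ?thesis by (meson less_le_trans less_imp_le norm_ge_zero)
next
  case False
  obtain f where f: "norm f * c < norm (blinfun_apply T f)"
  proof (rule ccontr)
    assume "\<not> thesis"
    then have "norm (blinfun_apply T f) \<le> c * norm f" for f
      using that by (metis mult.commute not_less)
    then show False
      using norm_blinfun_bound[of c T] False c by auto
  qed
  let ?g = "blinfun_apply T f"
  have "\<exists>F. finite F \<and> (norm f * c)\<^sup>2 < (\<Sum>x\<in>F. (cmod (ell2_fun ?g x))\<^sup>2)"
  proof (rule ccontr)
    assume "\<not> ?thesis"
    then have "norm ?g \<le> norm f * c"
      using False by (intro norm_ell2_le) (auto simp: not_less)
    with f show False by simp
  qed
  then obtain F where F: "finite F" "(norm f * c)\<^sup>2 < (\<Sum>x\<in>F. (cmod (ell2_fun ?g x))\<^sup>2)"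
    by blast
  obtain N where N: "\<And>x. x \<notin> range (\<lambda>t. s ^ N x * t)"
    using empty by metis
  define n where "n = Max (insert 0 (N ` F))"
  have avoid: "x \<notin> range (\<lambda>t. s ^ n * t)" if "x \<in> F" for x
  proof
    assume "x \<in> range (\<lambda>t. s ^ n * t)"
    then obtain t where t: "x = s ^ n * t" by blast
    have "N x \<le> n" using that F(1) by (simp add: n_def)
    then have "x = s ^ N x * (s ^ (n - N x) * t)"
      by (simp add: t mult.assoc[symmetric] power_add[symmetric])
    with N[of x] show False by blast
  qed
  have "c \<le> norm (T + (left_mult_op (s ^ n) o\<^sub>L X))" for X
  proof -
    let ?h = "blinfun_apply (T + (left_mult_op (s ^ n) o\<^sub>L X)) f"
    have "ell2_fun ?h x = ell2_fun ?g x" if "x \<in> F" for x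
      using left_mult_op_apply_outside[OF avoid[OF that]]
      by (simp add: blinfun.add_left plus_ell2.rep_eq)
    then have "(norm f * c)\<^sup>2 < (\<Sum>x\<in>F. (cmod (ell2_fun ?h x))\<^sup>2)"
      using F(2) by simp
    also have "\<dots> \<le> (norm ?h)\<^sup>2"
      by (rule sum_le_norm_ell2[OF F(1)])
    finally have "norm f * c < norm ?h"
      by (rule power2_less_imp_less) simp
    also have "\<dots> \<le> norm f * norm (T + (left_mult_op (s ^ n) o\<^sub>L X))"
      using norm_blinfun[of "T + (left_mult_op (s ^ n) o\<^sub>L X)" f] by (simp add: mult.commute)
    finally show ?thesis
      by (meson less_imp_le mult_less_cancel_left norm_ge_zero not_le)
  qed
  then show ?thesis by blast
qed


section \<open>Discontinuous derivations\<close>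

lemma scaleR_operator_eq_scaleC: "r *\<^sub>R T = complex_of_real r *\<^sub>O T"
proof (rule blinfun_eqI)
  have "r *\<^sub>R f = complex_of_real r *\<^sub>C f" for f :: "'a ell2"
    by transfer simp
  then show "blinfun_apply (r *\<^sub>R T) f = blinfun_apply (complex_of_real r *\<^sub>O T) f" for f
    by (simp add: blinfun.scaleR_left)
qed

lemma subspace_closed_subalgebra: "closed_subalgebra A \<Longrightarrow> subspace A"
  by (auto simp: subspace_def closed_subalgebra_def scaleR_operator_eq_scaleC)

text \<open>A derivation that is bounded by \<open>K\<close> on the \<open>e\<close>-ball of \<open>A\<close> is Lipschitz on \<open>A\<close> with constant
  \<open>K / e\<close>, by homogeneity and additivity.\<close>

lemma derivation_unbounded:
  assumes A: "closed_subalgebra A" and D: "derivation_on A D" and disc: "\<not> continuous_on A D"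
    and "0 < e"
  shows "\<exists>T\<in>A. norm T \<le> e \<and> K < norm (D T)"
proof (rule ccontr)
  assume "\<not> ?thesis"
  then have K: "\<And>T. T \<in> A \<Longrightarrow> norm T \<le> e \<Longrightarrow> norm (D T) \<le> K"
    by (meson not_le)
  note sub = subspace_closed_subalgebra[OF A]
  have scale: "D (r *\<^sub>R T) = r *\<^sub>R D T" if "T \<in> A" for r T
    using D that by (simp add: derivation_on_def scaleR_operator_eq_scaleC)
  have add: "D (S + T) = D S + D T" if "S \<in> A" "T \<in> A" for S T
    using D that by (simp add: derivation_on_def)
  have K0: "0 \<le> K"
    using K[of 0] subspace_0[OF sub] \<open>0 < e\<close> order_trans[OF norm_ge_zero, of "D 0" K] by simp
  have bound: "norm (D T) \<le> (K / e) * norm T" if T: "T \<in> A" for T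
  proof (cases "T = 0")
    case True
    then show ?thesis using scale[OF T, of 0] by simp
  next
    case False
    define r where "r = e / norm T"
    have "0 < r" using False \<open>0 < e\<close> by (simp add: r_def)
    have "norm (D (r *\<^sub>R T)) \<le> K"
      using False \<open>0 < e\<close> by (intro K subspace_scale[OF sub T]) (simp add: r_def)
    then have "r * norm (D T) \<le> K"
      using \<open>0 < r\<close> by (simp add: scale[OF T])
    then show ?thesis
      using False \<open>0 < e\<close> by (simp add: r_def field_simps)
  qed
  have "(K / e)-lipschitz_on A D"
  proof (rule lipschitz_onI)
    fix S T assume ST: "S \<in> A" "T \<in> A"
    have "D S = D (S - T) + D T"
      using add[OF subspace_diff[OF sub ST] ST(2)] by simp
    then show "dist (D S) (D T) \<le> (K / e) * dist S T"
      using bound[OF subspace_diff[OF sub ST]] by (simp add: dist_norm)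
  qed (use K0 \<open>0 < e\<close> in simp)
  then show False
    using disc lipschitz_on_continuous_on by blast
qed

lemma derivation_onD:
  assumes "derivation_on A D" "S \<in> A" "T \<in> A"
  shows "D (S + T) = D S + D T" "D (S o\<^sub>L T) = (S o\<^sub>L D T) + (D S o\<^sub>L T)"
  using assms by (simp_all add: derivation_on_def)

text \<open>The isometry \<open>V\<close> preserves the size of \<open>D B\<close>, while the error \<open>(D V) B\<close> and the constant
  \<open>D S\<close> stay bounded for bounded \<open>B\<close>.\<close>

lemma unbounded_on_translates:
  fixes A :: "'s::cancellative_monoid operator set"
  assumes A: "closed_subalgebra A" and D: "derivation_on A D" and disc: "\<not> continuous_on A D"
    and V: "left_mult_op s \<in> A" and S: "S \<in> A" and e: "0 < e"
  shows "\<exists>B\<in>A. norm B \<le> e \<and> K < norm (D (S + (left_mult_op s o\<^sub>L B)))"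
proof -
  let ?V = "left_mult_op s"
  obtain B where B: "B \<in> A" "norm B \<le> e" "K + norm (D ?V) * e + norm (D S) < norm (D B)"
    using derivation_unbounded[OF A D disc e] by blast
  have VB: "?V o\<^sub>L B \<in> A"
    using A V B(1) by (simp add: closed_subalgebra_def)
  have "norm (D ?V o\<^sub>L B) \<le> norm (D ?V) * e"
    by (rule order_trans[OF norm_blinfun_compose mult_left_mono[OF B(2)]]) simp
  moreover have "?V o\<^sub>L D B = D (S + (?V o\<^sub>L B)) - D S - (D ?V o\<^sub>L B)"
    by (simp add: derivation_onD[OF D S VB] derivation_onD[OF D V B(1)])
  then have "norm (D B) \<le> norm (D (S + (?V o\<^sub>L B))) + norm (D S) + norm (D ?V o\<^sub>L B)"
    by (metis (no_types) norm_left_mult_op_compose norm_triangle_ineq4 order_trans add_right_mono)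
  ultimately show ?thesis
    using B by force
qed


section \<open>Cells\<close>

definition cell :: "'s::cancellative_monoid operator set \<Rightarrow> 's operator \<Rightarrow> 's \<Rightarrow> real \<Rightarrow> 's operator set"
  where "cell A S v e = {S + (left_mult_op v o\<^sub>L B) | B. B \<in> A \<and> norm B \<le> e}"

lemma closed_cell:
  assumes A: "closed_subalgebra A"
  shows "closed (cell A S v e)"
proof -
  let ?V = "left_mult_op v"
  have "complete A"
    using A by (simp add: complete_eq_closed closed_subalgebra_def)
  then have "complete ((\<lambda>T. ?V o\<^sub>L T) ` A)"
    by (intro complete_isometric_image[where e = 1] subspace_closed_subalgebra[OF A]
        bounded_linear_compose_left) (simp_all add: norm_left_mult_op_compose)
  then have "closed ((+) S ` ((\<lambda>T. ?V o\<^sub>L T) ` A \<inter> cball 0 e))"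
    by (intro closed_translation closed_Int closed_cball) (simp add: complete_eq_closed)
  moreover have "cell A S v e = (+) S ` ((\<lambda>T. ?V o\<^sub>L T) ` A \<inter> cball 0 e)"
    by (auto simp: cell_def norm_left_mult_op_compose)
  ultimately show ?thesis by simp
qed

lemma center_in_cell: "closed_subalgebra A \<Longrightarrow> 0 \<le> e \<Longrightarrow> S \<in> cell A S v e"
  unfolding cell_def closed_subalgebra_def
  by (auto intro!: exI[of _ 0] simp: bounded_bilinear.zero_right[OF bounded_bilinear_blinfun_compose])

lemma dist_center_cell: "T \<in> cell A S v e \<Longrightarrow> dist T S \<le> e"
  by (auto simp: cell_def dist_norm norm_left_mult_op_compose)

lemma cell_nested:
  assumes A: "closed_subalgebra A" and w: "left_mult_op w \<in> A"
    and B: "B \<in> A" "norm B \<le> e / 2" and e': "e' \<le> e / 2"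
  shows "cell A (S + (left_mult_op v o\<^sub>L B)) (v * w) e' \<subseteq> cell A S v e"
proof
  fix T assume "T \<in> cell A (S + (left_mult_op v o\<^sub>L B)) (v * w) e'"
  then obtain C where C: "C \<in> A" "norm C \<le> e'"
    "T = S + (left_mult_op v o\<^sub>L B) + (left_mult_op (v * w) o\<^sub>L C)"
    by (auto simp: cell_def)
  let ?B = "B + (left_mult_op w o\<^sub>L C)"
  have "T = S + (left_mult_op v o\<^sub>L ?B)"
    by (simp add: C(3) left_mult_op_compose[symmetric] blinfun_eqI blinfun.add_left blinfun.add_right)
  moreover have "?B \<in> A"
    using A w B(1) C(1) by (simp add: closed_subalgebra_def)
  moreover have "norm ?B \<le> e"
    using norm_triangle_ineq[of B "left_mult_op w o\<^sub>L C"] B(2) C(2) e'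
    by (simp add: norm_left_mult_op_compose)
  ultimately show "T \<in> cell A S v e"
    unfolding cell_def by blast
qed

text \<open>For \<open>T = S' + V B\<close> in the new cell, \<open>D T\<close> consists of \<open>D S' + V (D B)\<close>, whose norm is large
  whatever \<open>D B\<close> is, and of \<open>(D V) B\<close>, whose norm is at most 1 by the choice of the radius \<open>e'\<close>.
  The radius comes last because it depends on \<open>D V\<close>, which is known only when \<open>V\<close> has been
  fixed.\<close>

lemma cell_refinement:
  fixes A :: "'s::cancellative_monoid operator set"
  assumes A: "closed_subalgebra A" and V: "range left_mult_op \<subseteq> A"
    and D: "derivation_on A D" and disc: "\<not> continuous_on A D"
    and empty: "\<And>x. \<exists>n. x \<notin> range (\<lambda>t. s ^ n * t)"
    and S: "S \<in> A" and e: "0 < e"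
  shows "\<exists>S'\<in>A. \<exists>n' e'. 0 < e' \<and> e' \<le> e / 2 \<and> cell A S' (s ^ n') e' \<subseteq> cell A S (s ^ n) e \<and>
    (\<forall>T\<in>cell A S' (s ^ n') e'. K \<le> norm (D T))"
proof -
  have VA: "left_mult_op v \<in> A" for v using V by blast
  obtain B where B: "B \<in> A" "norm B \<le> e / 2"
    "K + 1 < norm (D (S + (left_mult_op (s ^ n) o\<^sub>L B)))"
    using unbounded_on_translates[OF A D disc VA S half_gt_zero[OF e]] by blast
  define S' where "S' = S + (left_mult_op (s ^ n) o\<^sub>L B)"
  have S': "S' \<in> A"
    using A VA S B(1) by (simp add: S'_def closed_subalgebra_def)
  obtain m where m: "\<And>X. K + 1 \<le> norm (D S' + (left_mult_op (s ^ m) o\<^sub>L X))"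
    using norm_stable_under_translates[OF empty B(3)] unfolding S'_def by blast
  \<comment> \<open>The exponent \<open>m\<close> alone might be smaller than \<open>n\<close>, and then the cells would not be nested.\<close>
  define V' where "V' = left_mult_op (s ^ (n + m))"
  have large: "K + 1 \<le> norm (D S' + (V' o\<^sub>L X))" for X
  proof -
    have "V' o\<^sub>L X = left_mult_op (s ^ m) o\<^sub>L (left_mult_op (s ^ n) o\<^sub>L X)"
      by (simp add: V'_def add.commute[of n] power_add left_mult_op_compose[symmetric] blinfun_eqI)
    then show ?thesis by (simp add: m)
  qed
  define e' where "e' = min (e / 2) (1 / (norm (D V') + 1))"
  have pos: "0 < norm (D V') + 1"
    by (simp add: add_nonneg_pos)
  have e': "0 < e'" "e' \<le> e / 2"
    using e pos by (simp_all add: e'_def)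
  have "cell A S' (s ^ (n + m)) e' \<subseteq> cell A S (s ^ n) e"
    unfolding S'_def power_add by (rule cell_nested[OF A VA B(1,2) e'(2)])
  moreover have "K \<le> norm (D T)" if T: "T \<in> cell A S' (s ^ (n + m)) e'" for T
  proof -
    obtain C where C: "C \<in> A" "norm C \<le> e'" "T = S' + (V' o\<^sub>L C)"
      using T by (auto simp: cell_def V'_def)
    have V'A: "V' \<in> A" by (simp add: V'_def VA)
    then have V'C: "V' o\<^sub>L C \<in> A"
      using A C(1) by (simp add: closed_subalgebra_def)
    have "norm (D V' o\<^sub>L C) \<le> norm (D V') * norm C"
      by (rule norm_blinfun_compose)
    also have "\<dots> \<le> (norm (D V') + 1) * (1 / (norm (D V') + 1))"
      using C(2) by (intro mult_mono) (auto simp: e'_def)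
    also have "\<dots> = 1"
      using pos by simp
    finally have "norm (D V' o\<^sub>L C) \<le> 1" .
    moreover have "D S' + (V' o\<^sub>L D C) = D T - (D V' o\<^sub>L C)"
      by (simp add: C(3) derivation_onD[OF D S' V'C] derivation_onD[OF D V'A C(1)])
    then have "K + 1 \<le> norm (D T) + norm (D V' o\<^sub>L C)"
      by (metis large norm_triangle_ineq4 order_trans)
    ultimately show ?thesis by simp
  qed
  ultimately show ?thesis
    using S' e' by blast
qed


section \<open>Automatic continuity\<close>

theorem derivation_continuous_if_powers_vanish:
  fixes s :: "'s::cancellative_monoid"
  assumes empty: "\<And>x. \<exists>n. x \<notin> range (\<lambda>t. s ^ n * t)"
    and D: "derivation_on (semigroup_banach_algebra :: 's operator set) D"
  shows "continuous_on semigroup_banach_algebra D"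
proof (rule ccontr)
  let ?A = "semigroup_banach_algebra :: 's operator set"
  assume disc: "\<not> continuous_on ?A D"
  have A: "closed_subalgebra ?A" and V: "range left_mult_op \<subseteq> ?A"
    unfolding semigroup_banach_algebra_def
    by (rule closed_subalgebra_generated[OF left_mult_op_bounded_operators])+
  \<comment> \<open>A triple \<open>(S, n, e)\<close> stands for the cell with centre \<open>S\<close>, exponent \<open>n\<close> and radius \<open>e\<close>.\<close>
  define cl where "cl = (\<lambda>(S, n, e). cell ?A S (s ^ n) e)"
  define rad where "rad = (\<lambda>p :: 's operator \<times> nat \<times> real. snd (snd p))"
  define ok where "ok = (\<lambda>p :: 's operator \<times> nat \<times> real. fst p \<in> ?A \<and> 0 < rad p)"
  have "\<exists>p. \<forall>k. (ok (p k)) \<and> (rad (p (Suc k)) \<le> rad (p k) / 2 \<and>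
      cl (p (Suc k)) \<subseteq> cl (p k) \<and> (\<forall>T\<in>cl (p (Suc k)). real k \<le> norm (D T)))"
  proof (rule dependent_nat_choice)
    show "\<exists>p. ok p"
      using A by (intro exI[of _ "(0, 0, 1)"]) (simp add: ok_def rad_def closed_subalgebra_def)
    fix p k assume p: "ok p"
    obtain S n e where [simp]: "p = (S, n, e)" by (cases p)
    have "S \<in> ?A" "0 < e"
      using p by (simp_all add: ok_def rad_def)
    from cell_refinement[OF A V D disc empty this, of n "real k"]
    obtain S' n' e' where *: "S' \<in> ?A" "0 < e'" "e' \<le> e / 2"
      "cell ?A S' (s ^ n') e' \<subseteq> cell ?A S (s ^ n) e"
      "\<forall>T\<in>cell ?A S' (s ^ n') e'. real k \<le> norm (D T)"
      by blast
    then show "\<exists>q. ok q \<and> (rad q \<le> rad p / 2 \<and> cl q \<subseteq> cl p \<and> (\<forall>T\<in>cl q. real k \<le> norm (D T)))"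
      by (intro exI[of _ "(S', n', e')"]) (simp add: ok_def rad_def cl_def)
  qed
  then obtain p where ok: "\<And>k. ok (p k)"
    and half: "\<And>k. rad (p (Suc k)) \<le> rad (p k) / 2"
    and nested: "\<And>k. cl (p (Suc k)) \<subseteq> cl (p k)"
    and large: "\<And>k T. T \<in> cl (p (Suc k)) \<Longrightarrow> real k \<le> norm (D T)"
    by blast
  have cl_center: "cl q = cell ?A (fst q) (s ^ fst (snd q)) (rad q)" for q
    by (simp add: cl_def rad_def split_beta)
  have rad_le: "rad (p k) \<le> rad (p 0) * (1 / 2) ^ k" for k
  proof (induction k)
    case (Suc k)
    then show ?case using half[of k] by simp
  qed simp
  have "(\<lambda>k. rad (p 0) * (1 / 2) ^ k) \<longlonglongrightarrow> 0"
    by (intro tendsto_mult_right_zero LIMSEQ_realpow_zero) simp_all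
  have "\<exists>T. \<forall>k. T \<in> cl (p k)"
  proof (rule decreasing_closed_nest)
    show "closed (cl (p k))" for k
      by (simp add: cl_center closed_cell[OF A])
    show "cl (p k) \<noteq> {}" for k
      using center_in_cell[OF A, of "rad (p k)" "fst (p k)"] ok[of k]
      by (force simp: cl_center ok_def)
    show "cl (p n) \<subseteq> cl (p m)" if "m \<le> n" for m n
      using lift_Suc_antimono_le[of "\<lambda>k. cl (p k)", OF nested that] .
    fix e :: real assume "0 < e"
    then obtain k where "rad (p 0) * (1 / 2) ^ k < e / 2"
      using order_tendstoD(2)[OF \<open>_ \<longlonglongrightarrow> 0\<close>, of "e / 2"]
      by (auto simp: eventually_sequentially)
    then have "rad (p k) < e / 2"
      using rad_le[of k] by simp
    then have "dist T U < e" if "T \<in> cl (p k)" "U \<in> cl (p k)" for T U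
      using that dist_center_cell[of T] dist_center_cell[of U] dist_triangle2[of T U "fst (p k)"]
      unfolding cl_center by fastforce
    then show "\<exists>n. \<forall>x\<in>cl (p n). \<forall>y\<in>cl (p n). dist x y < e"
      by blast
  qed blast
  then obtain T where "\<And>k. T \<in> cl (p k)" by blast
  then have "real k \<le> norm (D T)" for k
    using large by blast
  then show False
    by (meson not_le reals_Archimedean2)
qed

text \<open>An additive length is the convenient way to see that the sets \<open>s\<^sup>n M\<close> have no common element.\<close>

corollary derivation_continuous_if_length:
  fixes s :: "'s::cancellative_monoid" and len :: "'s \<Rightarrow> nat"
  assumes len: "\<And>u v. len (u * v) = len u + len v" and s: "0 < len s"
    and D: "derivation_on (semigroup_banach_algebra :: 's operator set) D"
  shows "continuous_on semigroup_banach_algebra D"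
proof (rule derivation_continuous_if_powers_vanish[OF _ D])
  fix x
  have power: "n \<le> len (s ^ n)" for n
    by (induction n) (use s in \<open>auto simp: len\<close>)
  have "x \<noteq> s ^ Suc (len x) * t" for t
  proof
    assume "x = s ^ Suc (len x) * t"
    then have "len x = len (s ^ Suc (len x)) + len t"
      by (metis len)
    then show False
      using power[of "Suc (len x)"] by linarith
  qed
  then show "\<exists>n. x \<notin> range (\<lambda>t. s ^ n * t)" by blast
qed

lemma thompson_eq_length: "thompson_eq u v \<Longrightarrow> length u = length v"
  by (induction rule: thompson_eq.induct) auto

lift_definition thompson_length :: "thompson \<Rightarrow> nat" is length
  by (rule thompson_eq_length)

lemma thompson_length_mult: "thompson_length (u * v) = thompson_length u + thompson_length v"
  by transfer simp

lemma thompson_length_gen: "thompson_length (thompson_gen i) = 1"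
  by transfer simp

theorem theorem4p1:
  shows "(\<forall>D. derivation_on (semigroup_banach_algebra :: thompson operator set) D \<longrightarrow>
            continuous_on semigroup_banach_algebra D) \<and>
         (2 \<le> CARD('n::finite) \<longrightarrow>
           (\<forall>D. derivation_on (semigroup_banach_algebra :: 'n free_semigroup operator set) D \<longrightarrow>
              continuous_on semigroup_banach_algebra D))"
proof (intro conjI impI allI)
  fix D assume "derivation_on (semigroup_banach_algebra :: thompson operator set) D"
  then show "continuous_on semigroup_banach_algebra D"
    by (rule derivation_continuous_if_length[of thompson_length "thompson_gen 0", rotated 2])
      (simp_all add: thompson_length_mult thompson_length_gen)
next
  fix D assume "derivation_on (semigroup_banach_algebra :: 'n free_semigroup operator set) D"
  then show "continuous_on semigroup_banach_algebra D"
    by (rule derivation_continuous_if_length[of "\<lambda>w. length (letters w)" "Word [undefined]", rotated 2])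
      (simp_all add: times_free_semigroup_def)
qed

end
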